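(* Let $\mathbf f:\mathbb R\to\mathbb R^d$ be a smooth and convex flux function, let $\mathbf a(q):=\partial_q\mathbf f(q)$, and consider, in the absence of shocks, the scalar initial value problem $\partial_t q+\nabla\cdot\mathbf f(q)=0$, $q(0,\mathbf x)=q_0(\mathbf x)$, with $q:\mathbb R^+_0\times\mathbb R^d\to\mathbb R$. Let $\hat{\boldsymbol\xi}$ be the footpoint at time $0$ of the characteristic that passes through $\mathbf x$ at time $t$. Then $\hat{\boldsymbol\xi}^{(n)}$, given recursively by $$\hat{\boldsymbol\xi}^{(0)}=\mathbf x,\qquad \hat{\boldsymbol\xi}^{(n)}=\mathbf x-\mathbf a\big(q_0(\hat{\boldsymbol\xi}^{(n-1)})\big)\,t,\qquad n=1,2,\ldots$$ for $t\ge 0$, formally approximates $\hat{\boldsymbol\xi}$ to $n$-th order, i.e. $$\hat{\boldsymbol\xi}^{(n)}=\hat{\boldsymbol\xi}+\mathcal O(t^{n+1}).$$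
   Context: In the absence of shocks the conservation law can be rewritten as $\partial_t q+\mathbf a(q)\cdot\nabla q=0$. The characteristic through $(t,\mathbf x)$ is the curve $\boldsymbol\xi:\mathbb R^+_0\to\mathbb R^d$ with $\boldsymbol\xi'(s)=\mathbf a\big(q(s,\boldsymbol\xi(s))\big)$ and $\boldsymbol\xi(t)=\mathbf x$. The solution is constant along it, so it is a straight line. Its footpoint is $\hat{\boldsymbol\xi}=\boldsymbol\xi(0)$, and $q(t,\mathbf x)=q_0(\hat{\boldsymbol\xi})$ and $\mathbf x=\hat{\boldsymbol\xi}+\mathbf a(q_0(\hat{\boldsymbol\xi}))\,t$. *)

theory Defs
  imports "HOL-Analysis.Analysis" "HOL-Library.Landau_Symbols"
begin

text \<open>The space \<open>\<real>\<^sup>d\<close> is \<open>real ^ 'd\<close>. The solution exists without shocks on the time interval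
  \<open>[0, T)\<close>, where \<open>T\<close> is an extended real; \<open>T = \<infinity>\<close> gives all nonnegative times.\<close>

definition times_before :: "ereal \<Rightarrow> real set" where
  "times_before T = {s. 0 \<le> s \<and> ereal s < T}"

definition smooth_flux :: "(real \<Rightarrow> real ^ 'd) \<Rightarrow> bool" where
  "smooth_flux f \<longleftrightarrow>
     (\<forall>k u. (((\<lambda>g v. vector_derivative g (at v)) ^^ k) f) differentiable (at u))"

definition convex_flux :: "(real \<Rightarrow> real ^ 'd) \<Rightarrow> bool" where
  "convex_flux f \<longleftrightarrow> (\<forall>i. convex_on UNIV (\<lambda>u. f u $ i))"

definition velocity :: "(real \<Rightarrow> real ^ 'd) \<Rightarrow> real \<Rightarrow> real ^ 'd" where
  "velocity f u = vector_derivative f (at u)"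

definition divergence :: "(real ^ 'd \<Rightarrow> real ^ 'd) \<Rightarrow> real ^ 'd \<Rightarrow> real" where
  "divergence F y = (\<Sum>i\<in>UNIV. frechet_derivative F (at y) (axis i 1) $ i)"

text \<open>Continuous differentiability in space-time, up to and including the initial time, where the
  time derivative is one-sided. It also makes the derivatives in the conservation law below
  meaningful.\<close>

definition C1_until :: "(real \<Rightarrow> real ^ 'd \<Rightarrow> real) \<Rightarrow> ereal \<Rightarrow> bool" where
  "C1_until q T \<longleftrightarrow>
     (\<exists>q' :: real \<times> (real ^ 'd) \<Rightarrow> (real \<times> (real ^ 'd)) \<Rightarrow>\<^sub>L real.
        (\<forall>z \<in> times_before T \<times> UNIV.
           ((\<lambda>(s, y). q s y) has_derivative blinfun_apply (q' z))
             (at z within times_before T \<times> UNIV)) \<and>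
        continuous_on (times_before T \<times> UNIV) q')"

text \<open>``Absence of shocks'' means that the solution of the initial value problem is classical.\<close>

definition shock_free_solution ::
  "(real \<Rightarrow> real ^ 'd) \<Rightarrow> (real ^ 'd \<Rightarrow> real) \<Rightarrow> ereal \<Rightarrow> (real \<Rightarrow> real ^ 'd \<Rightarrow> real) \<Rightarrow> bool" where
  "shock_free_solution f q0 T q \<longleftrightarrow>
     C1_until q T \<and>
     (\<forall>s \<in> times_before T. \<forall>y.
        vector_derivative (\<lambda>r. q r y) (at s within times_before T)
          + divergence (\<lambda>z. f (q s z)) y = 0) \<and>
     (\<forall>y. q 0 y = q0 y)"

definition characteristic_through ::
  "(real \<Rightarrow> real ^ 'd) \<Rightarrow> ereal \<Rightarrow> (real \<Rightarrow> real ^ 'd \<Rightarrow> real) \<Rightarrow> real \<Rightarrow> real ^ 'd \<Rightarrow>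
     (real \<Rightarrow> real ^ 'd) \<Rightarrow> bool" where
  "characteristic_through f T q t x \<xi> \<longleftrightarrow>
     (\<forall>s \<in> times_before T.
        (\<xi> has_vector_derivative velocity f (q s (\<xi> s))) (at s within times_before T)) \<and>
     \<xi> t = x"

primrec footpoint_iter ::
  "(real \<Rightarrow> real ^ 'd) \<Rightarrow> (real ^ 'd \<Rightarrow> real) \<Rightarrow> real ^ 'd \<Rightarrow> real \<Rightarrow> nat \<Rightarrow> real ^ 'd" where
  "footpoint_iter f q0 x t 0 = x"
| "footpoint_iter f q0 x t (Suc n) = x - t *\<^sub>R velocity f (q0 (footpoint_iter f q0 x t n))"

end

theory Submission
  imports Defs
begin

text \<open>
  Along a characteristic \<open>\<xi>\<close> the conservation law says that the space-time derivative of \<open>q\<close>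
  vanishes in the direction \<open>(1, velocity f q)\<close>, which is the direction of the curve
  \<open>s \<mapsto> (s, \<xi> s)\<close>. Hence \<open>q\<close> is constant along \<open>\<xi>\<close>, the curve is a straight line, and its
  footpoint \<open>y\<close> satisfies \<open>x = y + t *\<^sub>R velocity f (q0 y)\<close>. With \<open>G = velocity f \<circ> q0\<close> the
  footpoint is therefore a fixed point of \<open>y \<mapsto> x - t *\<^sub>R G y\<close>, the map that is iterated.

  Since \<open>f\<close> is smooth and \<open>q0\<close> is continuously differentiable, \<open>G\<close> is Lipschitz near \<open>x\<close> with some
  constant \<open>L\<close>. As long as the iterate and the footpoint stay near \<open>x\<close>, each step multiplies the
  error by at most \<open>L * t\<close>, that is, it gains one order in \<open>t\<close>. The initial error is \<open>t\<close> times the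
  velocity along the characteristic.

  Nothing is known in advance about the position of the footpoint, and \<open>G\<close> may be unbounded on the
  whole space, so the fixed point equation does not by itself bring the footpoint close to \<open>x\<close> for
  small \<open>t\<close>. What does so is the constancy of \<open>q\<close> at the other end of the line: the velocity of the
  characteristic is \<open>velocity f (q t x)\<close>, and this stays bounded as \<open>t\<close> tends to \<open>0\<close>.
\<close>

section \<open>The time interval\<close>

lemma zero_in_times_before: "0 < T \<Longrightarrow> 0 \<in> times_before T"
  by (simp add: times_before_def zero_ereal_def)

lemma convex_times_before: "convex (times_before T)"
  unfolding is_interval_convex_1[symmetric] is_interval_1 times_before_def
  by (auto intro: le_less_trans simp flip: ereal_less_eq(3))

lemma eventually_in_times_before:
  assumes "s \<in> times_before T"
  shows "eventually (\<lambda>r. r \<in> times_before T) (at_right s)"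
proof -
  have s: "0 \<le> s" "ereal s < T"
    using assms by (auto simp: times_before_def)
  obtain b where b: "s < b" "ereal b < T"
    using ereal_dense2[OF s(2)] by auto
  have "eventually (\<lambda>r. r \<in> {s<..<b}) (at_right s)"
    using b(1) by (rule eventually_at_right_real)
  then show ?thesis
  proof eventually_elim
    case (elim r)
    then have "ereal r < T"
      using less_trans[OF _ b(2)] by simp
    then show ?case
      using s elim by (simp add: times_before_def)
  qed
qed

lemma at_within_times_before_not_bot:
  assumes "s \<in> times_before T"
  shows "at s within times_before T \<noteq> bot"
proof -
  have "at_right s \<le> at s within times_before T"
    using eventually_in_times_before[OF assms]
    by (auto simp: at_within_def le_inf_iff le_principal eventually_inf_principal
        elim: eventually_mono intro: le_infI1)
  then show ?thesis
    using trivial_limit_at_right_real[of s] by (metis bot.extremum_uniqueI)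
qed

section \<open>Differentiability of the velocity and of the solution\<close>

lemma smooth_flux_has_velocity:
  assumes "smooth_flux f"
  shows "(f has_vector_derivative velocity f u) (at u)"
  using assms[unfolded smooth_flux_def, rule_format, of 0 u]
  by (simp add: velocity_def vector_derivative_works)

lemma smooth_flux_velocity_C1:
  assumes "smooth_flux f"
  obtains a' where "\<And>u. (velocity f has_vector_derivative a' u) (at u)" "continuous_on UNIV a'"
proof
  let ?a' = "\<lambda>u. vector_derivative (velocity f) (at u)"
  have v: "velocity f = (\<lambda>v. vector_derivative f (at v))"
    by (simp add: velocity_def fun_eq_iff)
  show "(velocity f has_vector_derivative ?a' u) (at u)" for u
    using assms[unfolded smooth_flux_def, rule_format, of 1 u]
    by (simp add: v vector_derivative_works)
  show "continuous_on UNIV ?a'"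
    using assms[unfolded smooth_flux_def, rule_format, of 2]
    by (auto simp: v numeral_2_eq_2 intro!: continuous_at_imp_continuous_on
        differentiable_imp_continuous_within)
qed

lemma spatial_derivative:
  fixes q :: "real \<Rightarrow> 'a::real_normed_vector \<Rightarrow> real"
  assumes "((\<lambda>(s, y). q s y) has_derivative D) (at (s, y) within S \<times> UNIV)" and "s \<in> S"
  shows "(q s has_derivative (\<lambda>h. D (0, h))) (at y)"
proof -
  have "((\<lambda>z. (\<lambda>(s, y). q s y) (s, z)) has_derivative (\<lambda>h. D (0, h))) (at y)"
  proof (rule has_derivative_in_compose[where g = "\<lambda>(s, y). q s y"])
    show "((\<lambda>z. (s, z)) has_derivative (\<lambda>h. (0, h))) (at y)"
      by (auto intro!: derivative_eq_intros)
    show "((\<lambda>(s, y). q s y) has_derivative D) (at (s, y) within range (Pair s))"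
      using assms by (auto intro: has_derivative_subset)
  qed
  then show ?thesis by simp
qed

section \<open>Characteristics are straight lines\<close>

text \<open>By the chain rule the derivative of \<open>f \<circ> p\<close> at \<open>y\<close> is the rank-one map
  \<open>h \<mapsto> D h *\<^sub>R velocity f (p y)\<close>, and the divergence is its trace. This turns the conservation law
  into the transport equation.\<close>

lemma divergence_flux:
  fixes f :: "real \<Rightarrow> real ^ 'd" and p :: "real ^ 'd \<Rightarrow> real"
  assumes f: "smooth_flux f" and p: "(p has_derivative D) (at y)"
  shows "divergence (\<lambda>z. f (p z)) y = D (velocity f (p y))"
proof -
  interpret D: linear D
    using p by (rule has_derivative_linear)
  let ?a = "velocity f (p y)"
  have "((\<lambda>z. f (p z)) has_derivative (\<lambda>h. D h *\<^sub>R ?a)) (at y)"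
    using has_derivative_compose[OF p]
      smooth_flux_has_velocity[OF f, unfolded has_vector_derivative_def] by fastforce
  then have "frechet_derivative (\<lambda>z. f (p z)) (at y) = (\<lambda>h. D h *\<^sub>R ?a)"
    by (rule frechet_derivative_at[symmetric])
  then have "divergence (\<lambda>z. f (p z)) y = (\<Sum>i\<in>UNIV. D ((?a $ i) *\<^sub>R axis i 1))"
    by (simp add: divergence_def D.scaleR mult.commute)
  also have "\<dots> = D (\<Sum>i\<in>UNIV. (?a $ i) *\<^sub>R axis i 1)"
    by (simp add: D.sum)
  also have "(\<Sum>i\<in>UNIV. (?a $ i) *\<^sub>R axis i 1) = ?a"
    by (simp add: vec_eq_iff axis_def if_distrib cong: if_cong)
  finally show ?thesis .
qed

text \<open>With the divergence rewritten, the conservation law says that the space-time derivative of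
  \<open>q\<close> in the direction \<open>(1, velocity f q)\<close> is zero, and this is the tangent of
  \<open>s \<mapsto> (s, \<xi> s)\<close>. At the initial time all derivatives in time are one-sided.\<close>

lemma solution_constant_along_characteristic:
  fixes f :: "real \<Rightarrow> real ^ 'd"
  assumes f: "smooth_flux f" and sol: "shock_free_solution f q0 T q"
    and char: "characteristic_through f T q t x \<xi>"
    and s: "s \<in> times_before T" and r: "r \<in> times_before T"
  shows "q s (\<xi> s) = q r (\<xi> r)"
proof -
  let ?S = "times_before T"
  obtain q' where q': "\<And>s y. s \<in> ?S \<Longrightarrow>
      ((\<lambda>(s, y). q s y) has_derivative blinfun_apply (q' (s, y))) (at (s, y) within ?S \<times> UNIV)"
    using sol unfolding shock_free_solution_def C1_until_def by fastforce
  have "((\<lambda>s. q s (\<xi> s)) has_derivative (\<lambda>h. 0)) (at s within ?S)" if s: "s \<in> ?S" for s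
  proof -
    define a where "a = velocity f (q s (\<xi> s))"
    let ?D = "blinfun_apply (q' (s, \<xi> s))"
    have D_scale: "?D (h, h *\<^sub>R v) = h *\<^sub>R ?D (1, v)" for h v
      using blinfun.scaleR_right[of "q' (s, \<xi> s)" h "(1, v)"] by simp
    \<comment> \<open>Used for the constant curve, which gives the time derivative of \<open>q\<close>, and for \<open>\<xi>\<close> itself.\<close>
    have along: "((\<lambda>s. q s (z s)) has_vector_derivative ?D (1, v)) (at s within ?S)"
      if z: "(z has_vector_derivative v) (at s within ?S)" "z s = \<xi> s" for z v
    proof -
      have "((\<lambda>s. (\<lambda>(s, y). q s y) (s, z s)) has_derivative (\<lambda>h. ?D (h, h *\<^sub>R v))) (at s within ?S)"
      proof (rule has_derivative_in_compose[where g = "\<lambda>(s, y). q s y"])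
        show "((\<lambda>s. (s, z s)) has_derivative (\<lambda>h. (h, h *\<^sub>R v))) (at s within ?S)"
          using z(1) unfolding has_vector_derivative_def by (auto intro!: derivative_eq_intros)
        show "((\<lambda>(s, y). q s y) has_derivative ?D) (at (s, z s) within (\<lambda>s. (s, z s)) ` ?S)"
          using q'[OF s, of "\<xi> s"] z(2) by (auto intro: has_derivative_subset)
      qed
      then show ?thesis by (simp add: has_vector_derivative_def D_scale)
    qed
    have "((\<lambda>r. q r (\<xi> s)) has_vector_derivative ?D (1, 0)) (at s within ?S)"
      by (rule along) (auto intro!: derivative_eq_intros)
    then have "vector_derivative (\<lambda>r. q r (\<xi> s)) (at s within ?S) = ?D (1, 0)"
      by (rule vector_derivative_within[OF at_within_times_before_not_bot[OF s]])
    moreover have "divergence (\<lambda>z. f (q s z)) (\<xi> s) = ?D (0, a)"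
      unfolding a_def by (rule divergence_flux[OF f spatial_derivative[OF q'[OF s] s]])
    ultimately have "?D (1, 0) + ?D (0, a) = 0"
      using sol s unfolding shock_free_solution_def by metis
    then have "?D (1, a) = 0"
      by (simp flip: blinfun.add_right)
    moreover have "(\<xi> has_vector_derivative a) (at s within ?S)"
      using char s by (simp add: characteristic_through_def a_def)
    ultimately show ?thesis
      using along[of \<xi> a] by (simp add: has_vector_derivative_def)
  qed
  then show ?thesis
    using has_derivative_zero_unique[OF convex_times_before _ s r, of "\<lambda>s. q s (\<xi> s)"] by simp
qed

text \<open>As \<open>q\<close> is constant along the characteristic, so is its velocity. The value of \<open>q\<close> is taken at
  \<open>(t, x)\<close> because that point is given, whereas the footpoint is the unknown.\<close>

lemma characteristic_straight:
  fixes f :: "real \<Rightarrow> real ^ 'd"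
  assumes f: "smooth_flux f" and sol: "shock_free_solution f q0 T q"
    and char: "characteristic_through f T q t x \<xi>" and t: "t \<in> times_before T"
  shows "x = \<xi> 0 + t *\<^sub>R velocity f (q t x)" and "q0 (\<xi> 0) = q t x"
proof -
  let ?S = "times_before T" and ?a = "velocity f (q t x)"
  have z: "0 \<in> ?S"
    using t by (auto simp: times_before_def zero_ereal_def[symmetric] intro: le_less_trans
        simp flip: ereal_less_eq(5))
  have \<xi>t: "\<xi> t = x"
    using char by (simp add: characteristic_through_def)
  have const: "q s (\<xi> s) = q t x" if "s \<in> ?S" for s
    using solution_constant_along_characteristic[OF f sol char that t] \<xi>t by simp
  then show "q0 (\<xi> 0) = q t x"
    using z sol by (metis shock_free_solution_def)
  have "((\<lambda>s. \<xi> s - s *\<^sub>R ?a) has_derivative (\<lambda>h. 0)) (at s within ?S)" if "s \<in> ?S" for s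
  proof -
    have "(\<xi> has_vector_derivative ?a) (at s within ?S)"
      using char that const[OF that] by (metis characteristic_through_def)
    then show ?thesis
      unfolding has_vector_derivative_def by (auto intro!: derivative_eq_intros)
  qed
  then have "\<xi> t - t *\<^sub>R ?a = \<xi> 0 - 0 *\<^sub>R ?a"
    by (rule has_derivative_zero_unique[OF convex_times_before _ t z])
  then show "x = \<xi> 0 + t *\<^sub>R ?a"
    using \<xi>t by (simp add: algebra_simps)
qed

section \<open>Local estimates\<close>

text \<open>Both \<open>velocity f\<close> and \<open>q0\<close> are continuously differentiable, hence so is their composition,
  whose derivative is then bounded near every point.\<close>

lemma initial_velocity_locally_Lipschitz:
  fixes f :: "real \<Rightarrow> real ^ 'd"
  assumes f: "smooth_flux f" and sol: "shock_free_solution f q0 T q" and T: "0 < T"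
  obtains r L where "0 < r" "L-lipschitz_on (cball x r) (\<lambda>y. velocity f (q0 y))"
proof -
  let ?S = "times_before T"
  obtain q' where q': "\<And>y. ((\<lambda>(s, y). q s y) has_derivative blinfun_apply (q' (0, y)))
        (at (0, y) within ?S \<times> UNIV)"
    and q'_cont: "continuous_on (?S \<times> UNIV) q'"
    using sol zero_in_times_before[OF T]
    unfolding shock_free_solution_def C1_until_def by fastforce
  have q0: "q 0 = q0"
    using sol by (auto simp: shock_free_solution_def)
  obtain a' where a': "\<And>u. (velocity f has_vector_derivative a' u) (at u)"
    and a'_cont: "continuous_on UNIV a'"
    using smooth_flux_velocity_C1[OF f] by metis
  define Q :: "real ^ 'd \<Rightarrow> (real ^ 'd) \<Rightarrow>\<^sub>L real"
    where "Q y = q' (0, y) o\<^sub>L Blinfun (\<lambda>h. (0, h))" for y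
  have Q_apply: "blinfun_apply (Q y) h = q' (0, y) (0, h)" for y h
    by (simp add: Q_def bounded_linear_Blinfun_apply bounded_linear_Pair
        bounded_linear_zero bounded_linear_ident)
  have q0_deriv: "(q0 has_derivative Q y) (at y)" for y
    using spatial_derivative[OF q' zero_in_times_before[OF T], of y] by (simp add: q0 flip: Q_apply)
  have Q_cont: "continuous_on UNIV Q"
    unfolding Q_def using zero_in_times_before[OF T]
    by (auto intro!: continuous_intros continuous_on_compose2[OF q'_cont])
  define G' where "G' y = blinfun_scaleR_left (a' (q0 y)) o\<^sub>L Q y" for y
  have "((\<lambda>y. velocity f (q0 y)) has_derivative G' y) (at y)" for y
  proof -
    have "blinfun_apply (G' y) = (\<lambda>h. Q y h *\<^sub>R a' (q0 y))"
      by (simp add: G'_def fun_eq_iff)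
    then show ?thesis
      using has_derivative_compose[OF q0_deriv[of y] a'[of "q0 y", unfolded has_vector_derivative_def]]
      by simp
  qed
  moreover have "continuous_on UNIV G'"
    unfolding G'_def
    by (intro continuous_intros Q_cont continuous_on_compose2[OF a'_cont]
        bounded_linear.continuous_on[OF bounded_linear_blinfun_scaleR_left]
        has_derivative_continuous_on[OF has_derivative_at_withinI[OF q0_deriv]]) auto
  \<comment> \<open>The criterion is stated for time-dependent vector fields; here the time is a dummy.\<close>
  ultimately have "local_lipschitz UNIV UNIV (\<lambda>(_::real) y. velocity f (q0 y))"
    by (intro c1_implies_local_lipschitz[where f' = "\<lambda>p. G' (snd p)"])
      (auto intro!: continuous_intros continuous_on_compose2[of UNIV G'])
  then obtain r L where "0 < r" and
    "\<And>t. t \<in> cball (0::real) r \<inter> UNIV \<Longrightarrow> L-lipschitz_on (cball x r \<inter> UNIV) (\<lambda>y. velocity f (q0 y))"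
    by (rule local_lipschitzE[of _ _ _ 0 x, OF _ UNIV_I UNIV_I]) blast
  from this(1) this(2)[of 0] show ?thesis
    using that by simp
qed

text \<open>The characteristics that end in \<open>x\<close> at different small times have uniformly bounded
  velocities, because \<open>q\<close> is continuous at \<open>(0, x)\<close>. This makes their footpoints tend to \<open>x\<close>.\<close>

lemma velocity_at_point_bounded:
  fixes f :: "real \<Rightarrow> real ^ 'd"
  assumes f: "smooth_flux f" and sol: "shock_free_solution f q0 T q" and T: "0 < T"
  shows "(\<lambda>t. norm (velocity f (q t x))) \<in> O[at_right 0](\<lambda>_. 1)"
proof -
  let ?S = "times_before T"
  have z: "0 \<in> ?S" by (rule zero_in_times_before[OF T])
  obtain D where "((\<lambda>(s, y). q s y) has_derivative D) (at (0, x) within ?S \<times> UNIV)"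
    using sol z unfolding shock_free_solution_def C1_until_def by fastforce
  then have "((\<lambda>(s, y). q s y) \<longlongrightarrow> q 0 x) (at (0, x) within ?S \<times> UNIV)"
    using has_derivative_continuous by (fastforce simp: continuous_within)
  moreover have "filterlim (\<lambda>t. (t, x)) (at (0, x) within ?S \<times> UNIV) (at_right 0)"
    unfolding filterlim_at
    using eventually_in_times_before[OF z] eventually_at_right_less[of "0::real"]
    by (auto intro!: tendsto_eq_intros elim: eventually_elim2)
  ultimately have q_lim: "((\<lambda>t. q t x) \<longlongrightarrow> q 0 x) (at_right 0)"
    using filterlim_compose by fastforce
  obtain a' where "(velocity f has_vector_derivative a' (q 0 x)) (at (q 0 x))"
    using smooth_flux_velocity_C1[OF f] by metis
  then have "isCont (velocity f) (q 0 x)"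
    by (rule has_vector_derivative_continuous)
  then have "((\<lambda>t. norm (velocity f (q t x))) \<longlongrightarrow> norm (velocity f (q 0 x))) (at_right 0)"
    by (intro tendsto_norm isCont_tendsto_compose[OF _ q_lim])
  then show ?thesis
    by (intro bigoI_tendsto[where c = "norm (velocity f (q 0 x))"]) auto
qed

section \<open>Order of the fixed point iteration\<close>

text \<open>If the \<open>n\<close>-th iterate has error \<open>\<O>(t\<^sup>n\<^sup>+\<^sup>1)\<close>, then it tends to \<open>x\<close> like the footpoint does,
  so both eventually lie where the initial velocity is Lipschitz, and the next step multiplies the
  error by \<open>\<O>(t)\<close>.\<close>

lemma footpoint_iter_order:
  fixes f :: "real \<Rightarrow> real ^ 'd"
  assumes r: "0 < r" and lip: "L-lipschitz_on (cball x r) (\<lambda>y. velocity f (q0 y))"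
    and fixpt: "eventually (\<lambda>t. y t = x - t *\<^sub>R velocity f (q0 (y t))) (at_right 0)"
    and start: "(\<lambda>t. norm (x - y t)) \<in> O[at_right 0](\<lambda>t. t)"
  shows "(\<lambda>t. norm (footpoint_iter f q0 x t n - y t)) \<in> O[at_right 0](\<lambda>t. t ^ (n + 1))"
proof (induction n)
  case 0
  then show ?case using start by simp
next
  case (Suc n)
  let ?p = "\<lambda>t. footpoint_iter f q0 x t n"
  have small: "(g \<longlongrightarrow> 0) (at_right 0)"
    if "g \<in> O[at_right 0](\<lambda>t. t ^ (k + 1))" for g :: "real \<Rightarrow> real" and k
  proof -
    have "((\<lambda>t::real. t ^ (k + 1)) \<longlongrightarrow> 0) (at_right 0)"
      by (auto intro!: tendsto_eq_intros)
    then have "(\<lambda>t. t ^ (k + 1)) \<in> o[at_right 0](\<lambda>_. 1 :: real)"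
      by (intro smalloI_tendsto) auto
    with that have "g \<in> o[at_right 0](\<lambda>_. 1)"
      by (rule landau_o.big_small_trans)
    then show ?thesis
      using smalloD_tendsto by fastforce
  qed
  have y_lim: "((\<lambda>t. norm (x - y t)) \<longlongrightarrow> 0) (at_right 0)"
    using small[of _ 0] start by simp
  have p_lim: "((\<lambda>t. norm (?p t - y t)) \<longlongrightarrow> 0) (at_right 0)"
    using small Suc.IH by blast
  have "((\<lambda>t. norm (?p t - y t) + norm (x - y t)) \<longlongrightarrow> 0) (at_right 0)"
    using tendsto_add[OF p_lim y_lim] by simp
  then have near: "eventually (\<lambda>t. norm (?p t - y t) + norm (x - y t) < r) (at_right 0)"
    using r by (rule order_tendstoD)
  have "eventually (\<lambda>t. norm (footpoint_iter f q0 x t (Suc n) - y t)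
      \<le> L * norm (t * norm (?p t - y t))) (at_right 0)"
    using near fixpt eventually_at_right_less[of 0]
  proof eventually_elim
    case (elim t)
    have "norm (x - ?p t) \<le> norm (?p t - y t) + norm (x - y t)"
      by (metis norm_triangle_sub norm_minus_commute dist_norm dist_triangle3 add.commute)
    then have "?p t \<in> cball x r" "y t \<in> cball x r"
      unfolding mem_cball dist_norm using elim(1) norm_ge_zero[of "?p t - y t"] by linarith+
    then have "norm (velocity f (q0 (?p t)) - velocity f (q0 (y t))) \<le> L * norm (?p t - y t)"
      using lipschitz_onD[OF lip] by (simp add: dist_norm)
    moreover have "footpoint_iter f q0 x t (Suc n) - y t
        = (- t) *\<^sub>R (velocity f (q0 (?p t)) - velocity f (q0 (y t)))"
      by (subst elim(2)) (simp add: algebra_simps)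
    ultimately show ?case
      using elim(3) by (simp add: mult.left_commute mult_left_mono)
  qed
  then have "(\<lambda>t. norm (footpoint_iter f q0 x t (Suc n) - y t))
      \<in> O[at_right 0](\<lambda>t. t * norm (?p t - y t))"
    by (intro bigoI[where c = L]) simp
  also have "(\<lambda>t. t * norm (?p t - y t)) \<in> O[at_right 0](\<lambda>t. t * t ^ (n + 1))"
    by (intro landau_o.big.mult landau_o.big_refl Suc.IH)
  finally show ?case
    by simp
qed

theorem theorem3p1:
  fixes f :: "real \<Rightarrow> real ^ 'd"
    and q0 :: "real ^ 'd \<Rightarrow> real"
    and q :: "real \<Rightarrow> real ^ 'd \<Rightarrow> real"
    and T :: ereal
    and x :: "real ^ 'd"
    and \<xi> :: "real \<Rightarrow> real \<Rightarrow> real ^ 'd"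
    and \<xi>_hat :: "real \<Rightarrow> real ^ 'd"
    and n :: nat
  assumes "smooth_flux f" and "convex_flux f"
    and "0 < T"
    and "shock_free_solution f q0 T q"
    and "\<And>t. t \<in> times_before T \<Longrightarrow> characteristic_through f T q t x (\<xi> t)"
    and "\<And>t. t \<in> times_before T \<Longrightarrow> \<xi>_hat t = \<xi> t 0"
  shows "(\<lambda>t. norm (footpoint_iter f q0 x t n - \<xi>_hat t)) \<in> O[at_right 0](\<lambda>t. t ^ (n + 1))"
proof -
  have line: "\<xi>_hat t = x - t *\<^sub>R velocity f (q t x)" "q0 (\<xi>_hat t) = q t x"
    if "t \<in> times_before T" for t
    using characteristic_straight[OF assms(1,4) assms(5)[OF that] that] assms(6)[OF that]
    by (simp_all add: algebra_simps)
  have ev: "eventually (\<lambda>t. t \<in> times_before T) (at_right 0)"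
    by (rule eventually_in_times_before[OF zero_in_times_before[OF assms(3)]])
  obtain r L where "0 < r" "L-lipschitz_on (cball x r) (\<lambda>y. velocity f (q0 y))"
    using initial_velocity_locally_Lipschitz[OF assms(1,4,3)] by metis
  then show ?thesis
  proof (rule footpoint_iter_order)
    show "eventually (\<lambda>t. \<xi>_hat t = x - t *\<^sub>R velocity f (q0 (\<xi>_hat t))) (at_right 0)"
      using ev by eventually_elim (metis line)
    have "(\<lambda>t. t * norm (velocity f (q t x))) \<in> O[at_right 0](\<lambda>t. t * 1)"
      by (intro landau_o.big.mult landau_o.big_refl velocity_at_point_bounded[OF assms(1,4,3)])
    moreover have "eventually (\<lambda>t. norm (x - \<xi>_hat t) = t * norm (velocity f (q t x))) (at_right 0)"
      using ev by eventually_elim (simp add: line(1) times_before_def)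
    ultimately show "(\<lambda>t. norm (x - \<xi>_hat t)) \<in> O[at_right 0](\<lambda>t. t)"
      by (simp add: landau_o.big.in_cong)
  qed
qed

end
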